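(* Let $p_n$ denote the $n$-th prime and $\mathbb{P}$ the set of all primes. For a set $J$ of primes put $\mathbb{P}_J=\{p_n\mid n\in J\}$. Define $P^{(1)}=\mathbb{P}$ and $P^{(k)}=\mathbb{P}_{P^{(k-1)}}$ for $k\ge2$. Then for every integer $i\ge1$ there is a unique subset $J\subseteq P^{(i)}$ such that \[ P^{(i)}=J\cup\mathbb{P}_J\quad\text{and}\quad J\cap\mathbb{P}_J=\emptyset, \] i.e. $J=P^{(i)}-\mathbb{P}_J$.
   Context: $P^{(k)}$ is the set of $k$-th order primes: $P^{(1)}$ all primes, $P^{(2)}=\{p_{p_n}\}$ the prime-indexed primes, $P^{(3)}=\{p_{p_{p_n}}\}$, and so on. In the paper the set $J$ is named $\mathbb{P}^{(i)}$ and $\mathbb{P}_J$ is named $\mathbb{P}^{(i+1)}$, so the conclusion reads $\mathbb{P}^{(i)}=P^{(i)}-\mathbb{P}^{(i+1)}$. *)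

theory Defs
  imports "HOL-Library.Infinite_Set" "HOL-Computational_Algebra.Primes"
begin

(* p_n with p_1 = 2, p_2 = 3, ...; enumerate counts from 0, hence the shift.
   The value at n = 0 has no meaning and is never used, as 0 is not prime. *)
definition nth_prime :: "nat \<Rightarrow> nat" where
  "nth_prime n = enumerate {p. prime p} (n - 1)"

definition primes_indexed_by :: "nat set \<Rightarrow> nat set" where
  "primes_indexed_by J = {nth_prime n | n. n \<in> J}"

(* P^(k) for k \<ge> 1; left unspecified at k = 0. *)
fun order_primes :: "nat \<Rightarrow> nat set" where
  "order_primes (Suc 0) = {p. prime p}"
| "order_primes (Suc (Suc k)) = primes_indexed_by (order_primes (Suc k))"

end

theory Submission
  imports Defs
begin

text \<open>
  Since \<open>p\<^sub>n > n\<close>, the condition \<open>J = A - {p\<^sub>n | n \<in> J}\<close> decides whether \<open>x\<close> lies in \<open>J\<close> from the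
  elements of \<open>J\<close> below \<open>x\<close>, so it has exactly one solution by well-founded recursion. For
  \<open>A = order_primes i\<close> the partition condition is equivalent to it because \<open>p\<^sub>n \<in> A\<close> for all \<open>n \<in> A\<close>.
\<close>

text \<open>The kernel of the digraph on \<open>A\<close> with an arc from \<open>f y\<close> to
  \<open>y\<close>. Bounding \<open>y\<close> by \<open>x\<close> makes the recursion well-founded
  for every \<open>f\<close>, so that no growth condition enters the definition.\<close>

function in_kernel :: "('a::wellorder \<Rightarrow> 'a) \<Rightarrow> 'a set \<Rightarrow> 'a \<Rightarrow> bool" where
  [simp del]: "in_kernel f A x \<longleftrightarrow> x \<in> A \<and> \<not> (\<exists>y\<in>{..<x}. f y = x \<and> in_kernel f A y)"
  by pat_completeness auto
termination
  by (relation "inv_image {(x, y). x < y} (\<lambda>(f, A, x). x)") (auto intro: wf_inv_image wf)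

lemma ex1_eq_Diff_image:
  fixes f :: "'a::wellorder \<Rightarrow> 'a"
  assumes less: "\<And>x. x \<in> A \<Longrightarrow> x < f x"
  shows "\<exists>!J. J = A - f ` J"
proof (rule ex1I)
  show "{x. in_kernel f A x} = A - f ` {x. in_kernel f A x}"
  proof (rule set_eqI)
    fix x
    \<comment> \<open>The bound on \<open>y\<close> excludes nothing: \<open>in_kernel f A y\<close>
      forces \<open>y \<in> A\<close>, hence \<open>y < f y = x\<close>.\<close>
    have "(\<exists>y\<in>{..<x}. f y = x \<and> in_kernel f A y) \<longleftrightarrow> x \<in> f ` {x. in_kernel f A x}"
      using less in_kernel.simps[of f A] by blast
    then show "x \<in> {x. in_kernel f A x} \<longleftrightarrow> x \<in> A - f ` {x. in_kernel f A x}"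
      using in_kernel.simps[of f A x] by simp
  qed
next
  fix J
  assume J: "J = A - f ` J"
  have "x \<in> J \<longleftrightarrow> in_kernel f A x" for x
  proof (induction x rule: less_induct)
    case (less x)
    have "x \<in> J \<longleftrightarrow> x \<in> A \<and> x \<notin> f ` J"
      using J by blast
    \<comment> \<open>By its equation \<open>J\<close> lies in \<open>A\<close>, so every preimage
      of \<open>x\<close> in \<open>J\<close> is below \<open>x\<close> and within reach of the
      induction hypothesis.\<close>
    also have "x \<in> f ` J \<longleftrightarrow> (\<exists>y\<in>{..<x}. f y = x \<and> y \<in> J)"
      using J assms by blast
    also have "\<dots> \<longleftrightarrow> (\<exists>y\<in>{..<x}. f y = x \<and> in_kernel f A y)"
      using less.IH by blast
    finally show ?case
      using in_kernel.simps[of f A x] by blast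
  qed
  then show "J = {x. in_kernel f A x}"
    by blast
qed

lemma primes_indexed_by_eq_image: "primes_indexed_by J = nth_prime ` J"
  by (auto simp: primes_indexed_by_def)

lemma prime_nth_prime: "prime (nth_prime n)"
  using enumerate_in_set[OF primes_infinite] by (simp add: nth_prime_def)

lemma less_nth_prime:
  assumes "0 < n"
  shows "n < nth_prime n"
proof -
  \<comment> \<open>Entry \<open>k\<close> of the enumeration is the prime with index
    \<open>Suc k\<close>. The entries start above 1 and each step adds at least 1.\<close>
  have "Suc k < enumerate {p. prime p} k" for k
  proof (induction k)
    case 0
    have "prime (enumerate {p::nat. prime p} 0)"
      using enumerate_in_set[OF primes_infinite] by simp
    from prime_gt_1_nat[OF this] show ?case
      by simp
  next
    case (Suc k)
    then show ?case
      using enumerate_step[OF primes_infinite, of k] by linarith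
  qed
  from this[of "n - 1"] assms show ?thesis
    by (simp add: nth_prime_def)
qed

text \<open>Images under \<open>nth_prime\<close> preserve inclusion, so the case
  \<open>k = 0\<close>, where every value of \<open>nth_prime\<close> is prime, carries over to all
  orders.\<close>

lemma nth_prime_image_order_primes:
  "nth_prime ` order_primes (Suc k) \<subseteq> order_primes (Suc k)"
  by (induction k) (auto simp: primes_indexed_by_eq_image prime_nth_prime)

lemma prime_order_primes: "p \<in> order_primes (Suc k) \<Longrightarrow> prime p"
  by (cases k) (auto simp: primes_indexed_by_eq_image prime_nth_prime)

theorem theorem6p1:
  fixes i :: nat
  assumes "i \<ge> 1"
  shows "(\<exists>!J. J \<subseteq> order_primes i \<and>
                order_primes i = J \<union> primes_indexed_by J \<and>
                J \<inter> primes_indexed_by J = {})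
       \<and> (\<forall>J \<subseteq> order_primes i.
            (order_primes i = J \<union> primes_indexed_by J \<and> J \<inter> primes_indexed_by J = {})
            \<longleftrightarrow> J = order_primes i - primes_indexed_by J)"
proof -
  obtain k where i: "i = Suc k"
    using assms by (cases i) auto
  let ?A = "order_primes i"
  have closed: "nth_prime ` ?A \<subseteq> ?A"
    unfolding i by (rule nth_prime_image_order_primes)
  have partition_iff: "(?A = J \<union> primes_indexed_by J \<and> J \<inter> primes_indexed_by J = {})
      \<longleftrightarrow> J = ?A - primes_indexed_by J" if "J \<subseteq> ?A" for J
    using that closed unfolding primes_indexed_by_eq_image by blast
  have "\<exists>!J. J = ?A - primes_indexed_by J"
    unfolding primes_indexed_by_eq_image
    by (rule ex1_eq_Diff_image) (auto simp: i intro: less_nth_prime prime_gt_0_nat prime_order_primes)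
  \<comment> \<open>The equation for \<open>J\<close> already forces
    \<open>J \<subseteq> ?A\<close>, so uniqueness among all sets transfers to subsets of
    \<open>?A\<close>.\<close>
  moreover have "(J \<subseteq> ?A \<and> ?A = J \<union> primes_indexed_by J \<and> J \<inter> primes_indexed_by J = {})
      \<longleftrightarrow> J = ?A - primes_indexed_by J" for J
    using partition_iff[of J] by blast
  ultimately show ?thesis
    using partition_iff by simp
qed

end
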